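(* Let $G=(V,E,w)$ be a finite weighted graph without loop edges, where $(V,E)$ is a finite simple undirected graph with $|V|\ge 2$ and $w:E\to\mathbb{R}_{>0}$, and set $w_{xy}=w_{yx}=0$ whenever $xy\notin E$. For $x\in V$ and $X\subseteq V$ let $d_X(x)=\sum_{y\in X} w_{xy}$, let $d_G(x)=d_V(x)$, and let $W_G(x)=\max_{y\in V,\,y\neq x} w_{xy}$. Let $a,b:V\to\mathbb{R}_{\ge 0}$ be functions such that $d_G(x)\ge a(x)+b(x)+2W_G(x)$ for every $x\in V$. Then there exist disjoint non-empty sets $A,B$ with $A\cup B=V$ such that $d_A(x)\ge a(x)$ for every $x\in A$ and $d_B(x)\ge b(x)$ for every $x\in B$.
   Context: $d_X(x)$ is the degree of $x$ in the subgraph induced by $X$, i.e. the sum of weights of edges from $x$ to vertices of $X$. $W_G(x)$ is the maximum weight of an edge incident to $x$ (taken as $0$ if $x$ has no incident edge but other vertices exist). *)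

theory Defs
  imports Complex_Main
begin

locale weighted_graph =
  fixes V :: "'v set"
    and E :: "'v set set"
    and w :: "'v set \<Rightarrow> real"
  assumes finite_V: "finite V"
    and edges: "\<And>e. e \<in> E \<Longrightarrow> e \<subseteq> V \<and> card e = 2"
    and weight_pos: "\<And>e. e \<in> E \<Longrightarrow> w e > 0"

(* The values of w outside E are irrelevant; for x = y the set {x, y} is a
   singleton, hence never an edge, and the weight is 0. *)
definition pair_weight :: "'v set set \<Rightarrow> ('v set \<Rightarrow> real) \<Rightarrow> 'v \<Rightarrow> 'v \<Rightarrow> real" where
  "pair_weight E w x y = (if {x, y} \<in> E then w {x, y} else 0)"

definition weighted_degree :: "'v set set \<Rightarrow> ('v set \<Rightarrow> real) \<Rightarrow> 'v set \<Rightarrow> 'v \<Rightarrow> real" where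
  "weighted_degree E w X x = (\<Sum>y\<in>X. pair_weight E w x y)"

(* Only meaningful if V is finite and has a vertex other than x: Max is
   unspecified on the empty set. *)
definition max_incident_weight ::
    "'v set \<Rightarrow> 'v set set \<Rightarrow> ('v set \<Rightarrow> real) \<Rightarrow> 'v \<Rightarrow> real" where
  "max_incident_weight V E w x = Max (pair_weight E w x ` (V - {x}))"

end

theory Submission
  imports Defs
begin

text \<open>
  Call a set \<open>X\<close> cohesive for \<open>f\<close> if every vertex of \<open>X\<close> has degree at least \<open>f\<close> inside \<open>X\<close>, and call a
  set meager for \<open>f\<close> if none of its nonempty subsets is cohesive for \<open>f + W\<close>. Two disjoint nonempty
  sets, cohesive for \<open>a\<close> and \<open>b\<close> respectively, extend to a partition of this kind: enlarge them as long as
  possible; a vertex violating the condition when all remaining vertices are put on the \<open>b\<close>-side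
  could have been added to the \<open>a\<close>-side. So it suffices to find such a pair, following Stiebitz.

  If \<open>V\<close> has a partition into an \<open>a\<close>-meager set \<open>A\<close> and a \<open>b\<close>-meager set \<open>B\<close>, take one maximizing the
  total weight inside the parts plus \<open>b(A) + a(B)\<close>. Some \<open>x\<close> in \<open>A\<close> has \<open>d\<^sub>A(x) < a(x) + W(x)\<close>, and moving it
  to \<open>B\<close> increases this quantity, hence \<open>B \<union> {x}\<close> contains a set that is cohesive for \<open>b + W\<close>; removing \<open>x\<close>
  leaves a set inside \<open>B\<close> that is cohesive for \<open>b\<close>. Symmetrically for \<open>A\<close>.
  If there is no such partition, take a minimal nonempty set \<open>A\<close> that is cohesive for \<open>a\<close>. By
  minimality it is \<open>a\<close>-meager (up to the case of an isolated vertex), so its complement is not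
  \<open>b\<close>-meager and contains a set that is even cohesive for \<open>b + W\<close>.
\<close>

text \<open>\<open>W\<close> may be any vertexwise bound on the weights. As \<open>u_le_W\<close>
  includes \<open>y = x\<close>, it also yields \<open>0 \<le> W x\<close>.\<close>

locale bounded_weights =
  fixes V :: "'v set" and u :: "'v \<Rightarrow> 'v \<Rightarrow> real" and W :: "'v \<Rightarrow> real"
  assumes finite_V: "finite V"
    and u_sym: "u x y = u y x"
    and u_refl: "u x x = 0"
    and u_nonneg: "0 \<le> u x y"
    and u_le_W: "x \<in> V \<Longrightarrow> y \<in> V \<Longrightarrow> u x y \<le> W x"
begin

definition degree :: "'v set \<Rightarrow> 'v \<Rightarrow> real" where
  "degree X x = (\<Sum>y\<in>X. u x y)"

definition cohesive :: "('v \<Rightarrow> real) \<Rightarrow> 'v set \<Rightarrow> bool" where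
  "cohesive f X \<longleftrightarrow> (\<forall>x\<in>X. f x \<le> degree X x)"

definition meager :: "('v \<Rightarrow> real) \<Rightarrow> 'v set \<Rightarrow> bool" where
  "meager f A \<longleftrightarrow> (\<forall>X\<subseteq>A. X \<noteq> {} \<longrightarrow> \<not> cohesive (\<lambda>x. f x + W x) X)"

text \<open>The degree sums count each inner edge twice, hence the factors 2. The vertex terms are
  crossed: moving \<open>x\<close> from \<open>A\<close> to \<open>B\<close> gains
  \<open>2 * f x\<close> and loses \<open>2 * g x\<close> in them.\<close>

definition potential :: "('v \<Rightarrow> real) \<Rightarrow> ('v \<Rightarrow> real) \<Rightarrow> 'v set \<Rightarrow> 'v set \<Rightarrow> real" where
  "potential f g A B =
    (\<Sum>x\<in>A. degree A x) + (\<Sum>x\<in>B. degree B x) + 2 * (\<Sum>x\<in>A. g x) + 2 * (\<Sum>x\<in>B. f x)"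

section \<open>Effect of deleting, adding or moving one vertex\<close>

lemma potential_commute: "potential f g A B = potential g f B A"
  by (simp add: potential_def)

lemma W_nonneg: "x \<in> V \<Longrightarrow> 0 \<le> W x"
  using u_le_W[of x x] u_refl[of x] by simp

lemma degree_nonneg: "0 \<le> degree X x"
  by (simp add: degree_def u_nonneg sum_nonneg)

lemma degree_singleton: "degree {x} x = 0"
  by (simp add: degree_def u_refl)

lemma degree_mono: "X \<subseteq> Y \<Longrightarrow> finite Y \<Longrightarrow> degree X x \<le> degree Y x"
  unfolding degree_def by (intro sum_mono2) (auto simp: u_nonneg)

lemma degree_Un:
  "finite A \<Longrightarrow> finite B \<Longrightarrow> A \<inter> B = {} \<Longrightarrow> degree (A \<union> B) x = degree A x + degree B x"
  unfolding degree_def by (rule sum.union_disjoint)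

lemma degree_insert:
  "finite A \<Longrightarrow> y \<notin> A \<Longrightarrow> degree (insert y A) x = u x y + degree A x"
  by (simp add: degree_def)

lemma degree_eq_0: "x \<in> V \<Longrightarrow> W x = 0 \<Longrightarrow> X \<subseteq> V \<Longrightarrow> degree X x = 0"
  unfolding degree_def
proof (rule sum.neutral, rule ballI)
  fix y assume "x \<in> V" "W x = 0" "X \<subseteq> V" "y \<in> X"
  then show "u x y = 0" using u_le_W[of x y] u_nonneg[of x y] by auto
qed

lemma degree_Diff_singleton:
  assumes "X \<subseteq> V" "x \<in> X" "y \<in> V"
  shows "degree X x - W x \<le> degree (X - {y}) x"
proof (cases "y \<in> X")
  case True
  then have "degree X x = u x y + degree (X - {y}) x"
    using degree_insert[of "X - {y}" y x] finite_subset[OF assms(1) finite_V]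
    by (simp add: insert_absorb)
  moreover have "u x y \<le> W x" using u_le_W assms by auto
  ultimately show ?thesis by simp
next
  case False
  then show ?thesis using W_nonneg[of x] assms by auto
qed

text \<open>A remaining vertex loses at most the single edge to \<open>y\<close>, which the slack
  \<open>W\<close> pays for.\<close>

lemma cohesive_Diff_singleton:
  assumes "X \<subseteq> V" "y \<in> V" "cohesive (\<lambda>x. f x + W x) X"
  shows "cohesive f (X - {y})"
  unfolding cohesive_def
proof
  fix x assume "x \<in> X - {y}"
  then have "f x + W x \<le> degree X x" "degree X x - W x \<le> degree (X - {y}) x"
    using assms degree_Diff_singleton by (auto simp: cohesive_def)
  then show "f x \<le> degree (X - {y}) x" by simp
qed

lemma cohesive_weaken: "X \<subseteq> V \<Longrightarrow> cohesive (\<lambda>x. f x + W x) X \<Longrightarrow> cohesive f X"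
  unfolding cohesive_def using W_nonneg by (meson le_add_same_cancel1 order_trans subsetD)

lemma sum_degree_insert:
  assumes "finite A" "x \<notin> A"
  shows "(\<Sum>z\<in>insert x A. degree (insert x A) z) = (\<Sum>z\<in>A. degree A z) + 2 * degree A x"
proof -
  have "(\<Sum>z\<in>A. u z x) = degree A x"
    unfolding degree_def by (rule sum.cong) (auto simp: u_sym)
  then show ?thesis
    using assms by (simp add: degree_insert sum.distrib u_refl)
qed

lemma potential_move:
  assumes "finite A" "finite B" "x \<notin> A" "x \<notin> B"
  shows "potential f g A (insert x B) =
    potential f g (insert x A) B + 2 * (degree B x - degree A x + f x - g x)"
  unfolding potential_def sum_degree_insert[OF assms(1,3)] sum_degree_insert[OF assms(2,4)]
  using assms by (simp add: algebra_simps)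

section \<open>From a cohesive pair to a partition\<close>

lemma extend_cohesive_pair:
  assumes W: "\<And>x. x \<in> V \<Longrightarrow> a x + b x + 2 * W x \<le> degree V x"
    and AB: "A0 \<noteq> {}" "B0 \<noteq> {}" "A0 \<inter> B0 = {}" "A0 \<subseteq> V" "B0 \<subseteq> V" "cohesive a A0" "cohesive b B0"
  shows "\<exists>A B. A \<noteq> {} \<and> B \<noteq> {} \<and> A \<inter> B = {} \<and> A \<union> B = V \<and> cohesive a A \<and> cohesive b B"
proof -
  let ?P = "\<lambda>A. A0 \<subseteq> A \<and> A \<inter> B0 = {} \<and> A \<subseteq> V \<and> cohesive a A"
  define S where "S = {A. ?P A}"
  have "finite S" by (rule finite_subset[of _ "Pow V"]) (auto simp: finite_V S_def)
  moreover have "S \<noteq> {}" using AB by (auto simp: S_def)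
  ultimately obtain A where "A \<in> S" and "\<forall>A'\<in>S. A \<subseteq> A' \<longrightarrow> A = A'"
    using finite_has_maximal[of S] by blast
  then have A: "?P A" and max: "\<And>A'. ?P A' \<Longrightarrow> A \<subseteq> A' \<Longrightarrow> A = A'"
    by (simp_all add: S_def)
  have finA: "finite A" using A finite_V finite_subset by blast
  have "cohesive b (V - A)"
    unfolding cohesive_def
  proof (rule ballI, rule ccontr)
    fix x assume x: "x \<in> V - A" and less: "\<not> b x \<le> degree (V - A) x"
    have "x \<notin> B0"
    proof
      assume "x \<in> B0"
      then have "b x \<le> degree B0 x" using AB(7) by (simp add: cohesive_def)
      also have "\<dots> \<le> degree (V - A) x" using A AB(5) finite_V by (intro degree_mono) auto
      finally show False using less by simp
    qed
    have "degree V x = degree A x + degree (V - A) x"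
      using degree_Un[of A "V - A" x] A finA finite_V by (simp add: Un_absorb1)
    \<comment> \<open>By \<open>less\<close>, \<open>V - A\<close> receives less than
      \<open>b x\<close> of the degree, so more than \<open>a x + 2 * W x\<close> is left for
      \<open>A\<close>.\<close>
    then have "a x \<le> degree A x" using less W[of x] W_nonneg[of x] x by auto
    then have "cohesive a (insert x A)"
      using A degree_insert[OF finA, of x] x u_nonneg
      by (auto simp: cohesive_def u_refl intro: add_increasing)
    then have "A = insert x A" using A x \<open>x \<notin> B0\<close> by (intro max) auto
    then show False using x by blast
  qed
  moreover have "A \<noteq> {}" "V - A \<noteq> {}" "A \<inter> (V - A) = {}" "A \<union> (V - A) = V"
    using A AB by auto
  ultimately show ?thesis
    using A by (intro exI[of _ A] exI[of _ "V - A"]) simp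
qed

section \<open>Existence of a cohesive pair\<close>

lemma cohesive_subset_of_maximal:
  assumes W: "\<And>x. x \<in> V \<Longrightarrow> f x + g x + 2 * W x \<le> degree V x"
    and g: "\<And>x. x \<in> V \<Longrightarrow> 0 \<le> g x"
    and AB: "A \<union> B = V" "A \<inter> B = {}" "meager f A" "A \<noteq> {}"
    and max: "\<And>x. x \<in> A \<Longrightarrow> meager f (A - {x}) \<Longrightarrow> meager g (insert x B) \<Longrightarrow>
      potential f g (A - {x}) (insert x B) \<le> potential f g A B"
  shows "\<exists>X\<subseteq>B. X \<noteq> {} \<and> cohesive g X"
proof -
  obtain x where x: "x \<in> A" and less: "degree A x < f x + W x"
    using AB(3,4) unfolding meager_def cohesive_def by (meson not_le subset_refl)
  have xV: "x \<in> V" using x AB by auto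
  have fin: "finite A" "finite B" using finite_V AB(1) by auto
  have deg: "degree V x = degree A x + degree B x" using degree_Un fin AB by blast
  have "x \<notin> B" using x AB(2) by auto
  have "degree A x = degree (A - {x}) x"
    using degree_insert[of "A - {x}" x x] fin x by (simp add: insert_absorb u_refl)
  \<comment> \<open>Since \<open>degree B x = degree V x - degree A x\<close>, hypothesis
    \<open>W\<close> makes the gain at least \<open>4 * (f x + W x - degree A x)\<close>, which is
    positive.\<close>
  then have "potential f g A B < potential f g (A - {x}) (insert x B)"
    using potential_move[of "A - {x}" B x f g] less deg W[OF xV] fin x \<open>x \<notin> B\<close>
    by (simp add: insert_absorb)
  moreover have "meager f (A - {x})" using AB(3) unfolding meager_def by blast
  ultimately have "\<not> meager g (insert x B)" using max[OF x] by linarith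
  then obtain X where X: "X \<subseteq> insert x B" "X \<noteq> {}" "cohesive (\<lambda>x. g x + W x) X"
    unfolding meager_def by blast
  \<comment> \<open>Otherwise deleting \<open>x\<close> would leave nothing. A singleton has degree
    0, so \<open>W x = 0\<close> and \<open>x\<close> is isolated; then
    \<open>f x + g x \<le> 0\<close>, against \<open>0 \<le> degree A x < f x\<close>.\<close>
  have "X \<noteq> {x}"
  proof
    assume "X = {x}"
    then have "W x = 0"
      using X(3) g[OF xV] W_nonneg[OF xV] by (simp add: cohesive_def degree_singleton)
    then have "degree V x = 0" using degree_eq_0 xV by blast
    then show False
      using W[OF xV] less degree_nonneg[of A x] g[OF xV] \<open>W x = 0\<close> by simp
  qed
  then have "X - {x} \<noteq> {}" "X - {x} \<subseteq> B" using X(1,2) by auto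
  moreover have "cohesive g (X - {x})" using cohesive_Diff_singleton[OF _ xV X(3)] X(1) AB xV by blast
  ultimately show ?thesis by blast
qed

text \<open>Deleting a vertex from a subset cohesive for \<open>f + W\<close> leaves a set cohesive
  for \<open>f\<close>, which minimality forces to be empty. The subset is thus some
  \<open>{z}\<close>, whose degree 0 gives \<open>f z + W z \<le> 0\<close>, and by minimality it is
  all of \<open>A\<close>.\<close>

lemma minimal_cohesive_meager:
  assumes A: "A \<subseteq> V" "cohesive f A"
    and min: "\<And>X. X \<subset> A \<Longrightarrow> X \<noteq> {} \<Longrightarrow> \<not> cohesive f X"
    and not_isolated: "\<And>z. A = {z} \<Longrightarrow> 0 < f z + W z"
  shows "meager f A"
  unfolding meager_def
proof (intro allI impI notI)
  fix X assume X: "X \<subseteq> A" "X \<noteq> {}" "cohesive (\<lambda>x. f x + W x) X"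
  obtain z where z: "z \<in> X" using X by auto
  have "cohesive f (X - {z})" using cohesive_Diff_singleton[OF _ _ X(3)] X A z by blast
  moreover have "X - {z} \<subset> A" using X z by auto
  ultimately have Xz: "X = {z}" using min[of "X - {z}"] z by blast
  have "W z \<ge> 0" using X A z by (intro W_nonneg) auto
  then have "f z + W z \<le> 0" "cohesive f X"
    using X(3) by (auto simp: Xz cohesive_def degree_singleton)
  moreover from this have "A = {z}" using min[of X] X Xz by blast
  ultimately show False using not_isolated by fastforce
qed

theorem cohesive_partition:
  assumes card: "card V \<ge> 2"
    and a: "\<And>x. x \<in> V \<Longrightarrow> 0 \<le> a x" and b: "\<And>x. x \<in> V \<Longrightarrow> 0 \<le> b x"
    and W: "\<And>x. x \<in> V \<Longrightarrow> a x + b x + 2 * W x \<le> degree V x"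
  shows "\<exists>A B. A \<noteq> {} \<and> B \<noteq> {} \<and> A \<inter> B = {} \<and> A \<union> B = V \<and> cohesive a A \<and> cohesive b B"
proof -
  have "V \<noteq> {}" using card by auto
  have W': "b x + a x + 2 * W x \<le> degree V x" if "x \<in> V" for x using W[OF that] by simp
  have "a x + W x \<le> degree V x \<and> b x + W x \<le> degree V x" if "x \<in> V" for x
    using W[OF that] a[OF that] b[OF that] W_nonneg[OF that] by linarith
  then have coh: "cohesive (\<lambda>x. a x + W x) V" "cohesive (\<lambda>x. b x + W x) V"
    by (simp_all add: cohesive_def)
  \<comment> \<open>\<open>V\<close> is its own witness. Hence neither part of a partition into
    meager sets is empty.\<close>
  then have not_meager: "\<not> meager a V" "\<not> meager b V"
    using \<open>V \<noteq> {}\<close> unfolding meager_def by blast+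
  define P where "P A \<longleftrightarrow> A \<subseteq> V \<and> meager a A \<and> meager b (V - A)" for A
  have "\<exists>A B. A \<noteq> {} \<and> B \<noteq> {} \<and> A \<inter> B = {} \<and> A \<subseteq> V \<and> B \<subseteq> V \<and> cohesive a A \<and> cohesive b B"
  proof (cases "\<exists>A. P A")
    case True
    have fin: "finite {A. P A}"
      by (rule finite_subset[of _ "Pow V"]) (auto simp: finite_V P_def)
    let ?pot = "\<lambda>A. potential a b A (V - A)"
    have "Max (?pot ` {A. P A}) \<in> ?pot ` {A. P A}" using True fin by (intro Max_in) auto
    then obtain A where "P A" and A: "Max (?pot ` {A. P A}) = ?pot A" by auto
    have max: "?pot X \<le> ?pot A" if "P X" for X
      unfolding A[symmetric] using fin that by (intro Max_ge) auto
    have sub: "A \<subseteq> V" and mA: "meager a A" and mB: "meager b (V - A)"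
      using \<open>P A\<close> by (auto simp: P_def)
    have "A \<noteq> {}" using not_meager(2) mB by auto
    have "V - A \<noteq> {}" using not_meager(1) mA sub by (metis Diff_eq_empty_iff subset_antisym)
    have "\<exists>X\<subseteq>V - A. X \<noteq> {} \<and> cohesive b X"
    proof (rule cohesive_subset_of_maximal[OF W b _ _ mA \<open>A \<noteq> {}\<close>])
      fix x assume "x \<in> A" "meager a (A - {x})" "meager b (insert x (V - A))"
      moreover have "V - (A - {x}) = insert x (V - A)" using \<open>x \<in> A\<close> sub by auto
      ultimately show "potential a b (A - {x}) (insert x (V - A)) \<le> ?pot A"
        using max[of "A - {x}"] sub by (auto simp: P_def)
    qed (use sub in auto)
    then obtain B' where B': "B' \<subseteq> V - A" "B' \<noteq> {}" "cohesive b B'" by blast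
    \<comment> \<open>Roles exchanged: the vertex now moves from \<open>V - A\<close> to
      \<open>A\<close>, and \<open>potential_commute\<close> carries the maximality over.\<close>
    have "\<exists>X\<subseteq>A. X \<noteq> {} \<and> cohesive a X"
    proof (rule cohesive_subset_of_maximal[OF W' a _ _ mB \<open>V - A \<noteq> {}\<close>])
      fix x assume "x \<in> V - A" "meager b (V - A - {x})" "meager a (insert x A)"
      moreover have "V - insert x A = V - A - {x}" by auto
      ultimately show "potential b a (V - A - {x}) (insert x A) \<le> potential b a (V - A) A"
        using max[of "insert x A"] sub by (auto simp: P_def potential_commute[of b a])
    qed (use sub in auto)
    then obtain A' where A': "A' \<subseteq> A" "A' \<noteq> {}" "cohesive a A'" by blast
    have "A' \<inter> B' = {}" "A' \<subseteq> V" "B' \<subseteq> V" using A'(1) B'(1) sub by auto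
    then show ?thesis using A'(2,3) B'(2,3) by blast
  next
    case False
    let ?Q = "\<lambda>A. A \<noteq> {} \<and> A \<subseteq> V \<and> cohesive a A"
    define S where "S = {A. ?Q A}"
    have "finite S" by (rule finite_subset[of _ "Pow V"]) (auto simp: finite_V S_def)
    moreover have "V \<in> S"
      using \<open>V \<noteq> {}\<close> cohesive_weaken[OF subset_refl coh(1)] by (simp add: S_def)
    ultimately obtain A where "A \<in> S" and A_min: "\<forall>X\<in>S. X \<subseteq> A \<longrightarrow> A = X"
      using finite_has_minimal[of S] by blast
    then have A: "?Q A" by (simp add: S_def)
    have min: "\<not> cohesive a X" if "X \<subset> A" "X \<noteq> {}" for X
      using A_min that A unfolding S_def by blast
    show ?thesis
    proof (cases "\<exists>z. A = {z} \<and> a z + W z \<le> 0")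
      \<comment> \<open>Here \<open>z\<close> is isolated and \<open>{z}\<close> is not meager, but
        deleting \<open>z\<close> from \<open>V\<close>, which is cohesive for \<open>b + W\<close>,
        leaves a set cohesive for \<open>b\<close>.\<close>
      case True
      then obtain z where z: "A = {z}" "a z + W z \<le> 0" by blast
      then have zV: "z \<in> V" "W z = 0" using A a[of z] W_nonneg[of z] by auto
      have "V - {z} \<noteq> {}"
      proof
        assume "V - {z} = {}"
        then have "V \<subseteq> {z}" by auto
        then show False using card card_mono[of "{z}" V] by simp
      qed
      moreover have "cohesive b (V - {z})"
        using cohesive_Diff_singleton[OF subset_refl zV(1) coh(2)] .
      ultimately show ?thesis
        using A z by (intro exI[of _ A] exI[of _ "V - {z}"]) auto
    next
      case False
      have "meager a A"
      proof (rule minimal_cohesive_meager)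
        show "0 < a z + W z" if "A = {z}" for z
          using False that not_le by blast
      qed (use A min in auto)
      then have "\<not> meager b (V - A)" using \<open>\<nexists>A. P A\<close> A by (simp add: P_def)
      then obtain X where X: "X \<subseteq> V - A" "X \<noteq> {}" "cohesive (\<lambda>x. b x + W x) X"
        unfolding meager_def by blast
      have "cohesive b X" using cohesive_weaken[OF _ X(3)] X(1) by blast
      moreover have "A \<inter> X = {}" "X \<subseteq> V" using X(1) by auto
      ultimately show ?thesis
        using A X(2) by (intro exI[of _ A] exI[of _ X]) auto
    qed
  qed
  then show ?thesis
    by (elim exE conjE) (rule extend_cohesive_pair[OF W])
qed

end

section \<open>Transfer to weighted graphs\<close>

theorem theorem1:
  fixes V :: "'v set"
    and E :: "'v set set"
    and w :: "'v set \<Rightarrow> real"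
    and a b :: "'v \<Rightarrow> real"
  assumes "weighted_graph V E w"
    and "card V \<ge> 2"
    and "\<And>x. x \<in> V \<Longrightarrow> a x \<ge> 0"
    and "\<And>x. x \<in> V \<Longrightarrow> b x \<ge> 0"
    and "\<And>x. x \<in> V \<Longrightarrow>
      weighted_degree E w V x \<ge> a x + b x + 2 * max_incident_weight V E w x"
  shows "\<exists>A B. A \<noteq> {} \<and> B \<noteq> {} \<and> A \<inter> B = {} \<and> A \<union> B = V \<and>
    (\<forall>x\<in>A. weighted_degree E w A x \<ge> a x) \<and>
    (\<forall>x\<in>B. weighted_degree E w B x \<ge> b x)"
proof -
  interpret weighted_graph V E w by fact
  let ?u = "pair_weight E w" and ?W = "max_incident_weight V E w"
  have refl: "?u x x = 0" for x using edges[of "{x}"] by (auto simp: pair_weight_def)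
  have nonneg: "0 \<le> ?u x y" for x y
    using weight_pos[of "{x, y}"] by (auto simp: pair_weight_def intro: less_imp_le)
  have Max_ge_u: "?u x y \<le> ?W x" if "y \<in> V" "y \<noteq> x" for x y
    unfolding max_incident_weight_def using that finite_V by (intro Max_ge) auto
  interpret bounded_weights V ?u ?W
  proof
    show "?u x y \<le> ?W x" if xy: "x \<in> V" "y \<in> V" for x y
    proof (cases "x = y")
      case True
      \<comment> \<open>\<open>?W x\<close> is a maximum over \<open>V - {x}\<close>, so on the
        diagonal a second vertex is used to obtain \<open>0 \<le> ?W x\<close>.\<close>
      have "V \<noteq> {x}" using \<open>card V \<ge> 2\<close> by auto
      then obtain z where "z \<in> V" "z \<noteq> x" using xy by auto
      then have "0 \<le> ?W x" using Max_ge_u nonneg order_trans by blast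
      then show ?thesis using True refl by simp
    qed (use xy Max_ge_u in auto)
    show "?u x y = ?u y x" for x y by (simp add: pair_weight_def insert_commute)
  qed (simp_all add: finite_V refl nonneg)
  have "degree = weighted_degree E w"
    by (intro ext) (simp add: degree_def weighted_degree_def)
  then show ?thesis
    using cohesive_partition[of a b] assms unfolding cohesive_def by simp
qed

end
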